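(* Let $d\ge 1$ and let $\{\Pi_x\}_{x=0}^{d-1}$, $\Pi_x=|x\rangle\langle x|$, be the rank-one projectors onto the vectors of an orthonormal basis $\{|x\rangle\}_{x=0}^{d-1}$ of $\mathbb{C}^d$, so that $\sum_x \Pi_x=\mathbb{1}$. Then there exist a finite family of Kraus operators $\{K_m\}$ on $\mathbb{C}^d$ (so $\sum_m K_m^\dagger K_m=\mathbb{1}$) that is realized by an ancilla-assisted measurement with a $d$-dimensional ancilla and an informationally complete measurement on that ancilla, and complex coefficients $\gamma_{xm}$, such that for every $x\in\{0,\dots,d-1\}$ and every density matrix $\rho$ on $\mathbb{C}^d$, $$\rho\,\Pi_x=\sum_m \gamma_{xm}\,K_m\rho K_m^\dagger .$$
   Context: A family of Kraus operators $\{K_m\}$ on the system $\mathbb{C}^d$ is said to be realized by an ancilla-assisted measurement with a $d$-dimensional ancilla and an informationally complete measurement on the ancilla if there exist: a unitary $U$ on $\mathbb{C}^d\otimes\mathbb{C}^d$ (system $\otimes$ ancilla), a unit vector $|0\rangle_R\in\mathbb{C}^d$ (initial ancilla state), and a finite family of unit vectors $\{|\phi_m\rangle\}$ in the ancilla space $\mathbb{C}^d$ such that the projectors $\{|\phi_m\rangle\langle\phi_m|\}$ are informationally complete and $\sum_m|\phi_m\rangle\langle\phi_m|=\alpha\mathbb{1}$ for some $\alpha>0$, with $$K_m=\frac{1}{\sqrt{\alpha}}\,(\mathbb{1}\otimes\langle\phi_m|)\,U\,(\mathbb{1}\otimes|0\rangle_R)\quad\text{for all } m.$$ Informationally complete means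 that the projectors $|\phi_m\rangle\langle\phi_m|$ span, over $\mathbb{C}$, the space of all operators on $\mathbb{C}^d$. The coefficients $\gamma_{xm}$ do not depend on $\rho$. *)

theory Defs
  imports "HOL-Analysis.Analysis"
begin

text \<open>
  Operators on \<open>\<complex>\<^sup>d\<close> are matrices over a finite index type \<open>'n\<close> with \<open>CARD('n) = d\<close>; the tensor product
  of two such spaces is indexed by the product type, system component first, ancilla second.
\<close>

definition cinner :: "complex ^ 'n \<Rightarrow> complex ^ 'n \<Rightarrow> complex"
  where "cinner v w = (\<Sum>i\<in>UNIV. cnj (v $ i) * w $ i)"

definition adj :: "complex ^ 'n ^ 'm \<Rightarrow> complex ^ 'm ^ 'n"
  where "adj A = (\<chi> i j. cnj (A $ j $ i))"

definition unitary :: "complex ^ 'n ^ 'n \<Rightarrow> bool"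
  where "unitary U \<longleftrightarrow> adj U ** U = mat 1 \<and> U ** adj U = mat 1"

definition proj :: "complex ^ 'n \<Rightarrow> complex ^ 'n ^ 'n"
  where "proj v = (\<chi> i j. v $ i * cnj (v $ j))"

text \<open>
  The library scaling \<open>*s\<close> on \<open>complex ^ 'n ^ 'n\<close> takes its scalars from \<open>complex ^ 'n\<close>, so complex
  scalar multiplication of matrices is introduced separately.
\<close>

definition cscale :: "complex \<Rightarrow> complex ^ 'n ^ 'm \<Rightarrow> complex ^ 'n ^ 'm"  (infixr "*\<^sub>M" 75)
  where "c *\<^sub>M A = (\<chi> i j. c * A $ i $ j)"

interpretation cmat: vector_space "cscale :: complex \<Rightarrow> complex ^ 'n ^ 'm \<Rightarrow> complex ^ 'n ^ 'm"
  by unfold_locales (simp_all add: cscale_def vec_eq_iff algebra_simps)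

definition psd :: "complex ^ 'n ^ 'n \<Rightarrow> bool"
  where "psd A \<longleftrightarrow> adj A = A \<and> (\<forall>v. 0 \<le> Re (cinner v (A *v v)))"

definition density_matrix :: "complex ^ 'n ^ 'n \<Rightarrow> bool"
  where "density_matrix \<rho> \<longleftrightarrow> psd \<rho> \<and> trace \<rho> = 1"

definition orthonormal_basis :: "(nat \<Rightarrow> complex ^ 'n) \<Rightarrow> bool"
  where "orthonormal_basis e \<longleftrightarrow>
    (\<forall>x<CARD('n). \<forall>y<CARD('n). cinner (e x) (e y) = (if x = y then 1 else 0)) \<and>
    vec.span (e ` {..<CARD('n)}) = UNIV"

text \<open>
  The matrices of \<open>\<one> \<otimes> |v\<rangle>\<close> and \<open>\<one> \<otimes> \<langle>v|\<close>: Kronecker products of the identity with a column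
  (resp. row), where the one-element index of the column (resp. row) is dropped.
\<close>

definition id_tensor_ket :: "complex ^ 'r \<Rightarrow> complex ^ 'n ^ ('n \<times> 'r)"
  where "id_tensor_ket v = (\<chi> p j. (mat 1 :: complex ^ 'n ^ 'n) $ fst p $ j * v $ snd p)"

definition id_tensor_bra :: "complex ^ 'r \<Rightarrow> complex ^ ('n \<times> 'r) ^ 'n"
  where "id_tensor_bra v = (\<chi> i p. (mat 1 :: complex ^ 'n ^ 'n) $ i $ fst p * cnj (v $ snd p))"

text \<open>Families with \<open>M\<close> members are functions on \<open>nat\<close>, read on \<open>{..<M}\<close> only.\<close>

definition kraus_family :: "nat \<Rightarrow> (nat \<Rightarrow> complex ^ 'n ^ 'n) \<Rightarrow> bool"
  where "kraus_family M K \<longleftrightarrow> (\<Sum>m<M. adj (K m) ** K m) = mat 1"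

definition informationally_complete :: "nat \<Rightarrow> (nat \<Rightarrow> complex ^ 'n) \<Rightarrow> bool"
  where "informationally_complete M \<phi> \<longleftrightarrow> cmat.span ((\<lambda>m. proj (\<phi> m)) ` {..<M}) = UNIV"

definition realized_by_ic_ancilla :: "nat \<Rightarrow> (nat \<Rightarrow> complex ^ 'n ^ 'n) \<Rightarrow> bool"
  where "realized_by_ic_ancilla M K \<longleftrightarrow>
    (\<exists>(U :: complex ^ ('n \<times> 'n) ^ ('n \<times> 'n)) (r :: complex ^ 'n) (\<phi> :: nat \<Rightarrow> complex ^ 'n) (\<alpha> :: real).
      unitary U \<and> norm r = 1 \<and>
      (\<forall>m<M. norm (\<phi> m) = 1) \<and>
      informationally_complete M \<phi> \<and>
      \<alpha> > 0 \<and> (\<Sum>m<M. proj (\<phi> m)) = \<alpha> *\<^sub>R mat 1 \<and>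
      (\<forall>m<M. K m = (1 / sqrt \<alpha>) *\<^sub>R (id_tensor_bra (\<phi> m) ** U ** id_tensor_ket r)))"

end

theory Submission
  imports Defs "HOL-Combinatorics.Transposition"
begin

text \<open>
  Let the system control the ancilla through \<open>U = \<Sum>\<^sub>j \<Pi>\<^sub>j \<otimes> S\<^sub>j\<close>, where \<open>S\<^sub>j\<close> is the permutation matrix
  exchanging the ancilla basis vectors \<open>0\<close> and \<open>j\<close>. Starting from \<open>|0\<rangle>\<close> this yields
  \<open>K\<^sub>m = (1 / sqrt \<alpha>) \<Sum>\<^sub>j \<langle>\<phi>\<^sub>m|j\<rangle> \<Pi>\<^sub>j\<close>, so that \<open>\<Sum>\<^sub>m \<gamma>\<^sub>m K\<^sub>m \<rho> K\<^sub>m\<^sup>\<dagger>\<close> is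
  \<open>\<Sum>\<^sub>s\<^sub>t A\<^sub>t\<^sub>s \<Pi>\<^sub>s \<rho> \<Pi>\<^sub>t / \<alpha>\<close> with \<open>A = \<Sum>\<^sub>m \<gamma>\<^sub>m |\<phi>\<^sub>m\<rangle>\<langle>\<phi>\<^sub>m|\<close>. By informational completeness
  \<open>A\<close> is arbitrary, and \<open>A\<^sub>t\<^sub>s = \<alpha> \<delta>\<^sub>t\<^sub>x\<close> gives \<open>\<Sum>\<^sub>s \<Pi>\<^sub>s \<rho> \<Pi>\<^sub>x = \<rho> \<Pi>\<^sub>x\<close>.
\<close>

section \<open>Algebra of complex scaling, adjoints and rank-one projectors\<close>

lemma cscale_nth [simp]: "(c *\<^sub>M A) $ i $ j = c * A $ i $ j"
  by (simp add: cscale_def)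

lemma adj_nth [simp]: "adj A $ i $ j = cnj (A $ j $ i)"
  by (simp add: adj_def)

lemma proj_nth [simp]: "proj v $ i $ j = v $ i * cnj (v $ j)"
  by (simp add: proj_def)

lemma adj_adj [simp]: "adj (adj A) = A"
  by (simp add: vec_eq_iff)

lemma adj_proj [simp]: "adj (proj v) = proj v"
  by (simp add: vec_eq_iff)

lemma adj_sum: "adj (\<Sum>i\<in>I. A i) = (\<Sum>i\<in>I. adj (A i))"
  by (simp add: vec_eq_iff)

lemma adj_cscale: "adj (c *\<^sub>M A) = cnj c *\<^sub>M adj A"
  by (simp add: vec_eq_iff)

lemma cscale_matrix_mult_left: "(c *\<^sub>M A) ** B = c *\<^sub>M (A ** B)"
  by (simp add: vec_eq_iff matrix_matrix_mult_def sum_distrib_left mult.assoc)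

lemma cscale_matrix_mult_right: "A ** (c *\<^sub>M B) = c *\<^sub>M (A ** B)"
  by (simp add: vec_eq_iff matrix_matrix_mult_def sum_distrib_left mult.left_commute)

lemma sum_matrix_mult_left:
  fixes A :: "'i \<Rightarrow> complex ^ 'n ^ 'm" and B :: "complex ^ 'p ^ 'n"
  shows "(\<Sum>i\<in>I. A i) ** B = (\<Sum>i\<in>I. A i ** B)"
  by (simp add: vec_eq_iff matrix_matrix_mult_def sum_distrib_right) (intro allI sum.swap)

lemma sum_matrix_mult_right:
  fixes A :: "complex ^ 'n ^ 'm" and B :: "'i \<Rightarrow> complex ^ 'p ^ 'n"
  shows "A ** (\<Sum>i\<in>I. B i) = (\<Sum>i\<in>I. A ** B i)"
  by (simp add: vec_eq_iff matrix_matrix_mult_def sum_distrib_left) (intro allI sum.swap)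

lemma sum_rotate:
  "(\<Sum>a\<in>A. \<Sum>b\<in>B. \<Sum>c\<in>C. f a b c) = (\<Sum>b\<in>B. \<Sum>c\<in>C. \<Sum>a\<in>A. f a b c)"
  by (subst sum.swap) (intro sum.cong refl sum.swap)

lemma proj_mult_proj: "proj v ** proj w = cinner v w *\<^sub>M (\<chi> i j. v $ i * cnj (w $ j))"
  by (simp add: vec_eq_iff matrix_matrix_mult_def cinner_def sum_distrib_left sum_distrib_right
      mult_ac)

text \<open>Take the \<open>f j\<close> as columns of a square matrix \<open>B\<close>.
  Orthonormality makes \<open>adj B\<close> a left inverse, hence also a right inverse, and
  \<open>B ** adj B\<close> is the sum of the projectors.\<close>

lemma sum_proj_orthonormal:
  fixes f :: "'n \<Rightarrow> complex ^ 'n"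
  assumes "\<And>j k. cinner (f j) (f k) = (if j = k then 1 else 0)"
  shows "(\<Sum>j\<in>UNIV. proj (f j)) = mat 1"
proof -
  define B :: "complex ^ 'n ^ 'n" where "B = (\<chi> i j. f j $ i)"
  have "adj B ** B = mat 1"
    using assms by (simp add: B_def vec_eq_iff matrix_matrix_mult_def mat_def cinner_def)
  then have "B ** adj B = mat 1"
    by (simp add: matrix_left_right_inverse)
  moreover have "B ** adj B = (\<Sum>j\<in>UNIV. proj (f j))"
    by (simp add: B_def vec_eq_iff matrix_matrix_mult_def)
  ultimately show ?thesis by simp
qed

subsection \<open>An informationally complete tight frame\<close>

definition matrix_unit :: "'m \<Rightarrow> 'n \<Rightarrow> complex ^ 'n ^ 'm"
  where "matrix_unit a b = (\<chi> i j. if i = a \<and> j = b then 1 else 0)"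

lemma matrix_unit_expansion:
  "A = (\<Sum>j\<in>UNIV. \<Sum>k\<in>UNIV. A $ j $ k *\<^sub>M matrix_unit j k)"
proof -
  have "(\<Sum>j\<in>UNIV. \<Sum>k\<in>UNIV. A $ j $ k * (if a = j \<and> b = k then 1 else 0)) = A $ a $ b" for a b
  proof -
    have "(\<Sum>j\<in>UNIV. \<Sum>k\<in>UNIV. A $ j $ k * (if a = j \<and> b = k then 1 else 0))
        = (\<Sum>j\<in>UNIV. if a = j then (\<Sum>k\<in>UNIV. if b = k then A $ j $ k else 0) else 0)"
      by (intro sum.cong refl) (auto simp: if_distrib cong: if_cong)
    then show ?thesis by simp
  qed
  then show ?thesis by (simp add: vec_eq_iff matrix_unit_def)
qed

lemma sum_matrix_unit_diag: "(\<Sum>j\<in>UNIV. matrix_unit j j) = mat 1"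
proof -
  have "(\<Sum>j\<in>UNIV. if a = j \<and> b = j then 1 else 0) = (if a = b then 1 else 0 :: complex)" for a b :: 'a
    by (cases "a = b") (auto intro: sum.neutral)
  then show ?thesis by (simp add: vec_eq_iff matrix_unit_def mat_def)
qed

text \<open>With n < 4 the off-diagonal vectors carry the four phases of the polarization identity.
  Repeating the basis vector for every n gives the pairs with j = k the same total weight as the
  others, which makes the frame tight.\<close>

definition frame_vec :: "'n \<times> 'n \<times> nat \<Rightarrow> complex ^ 'n"
  where "frame_vec = (\<lambda>(j, k, n). if j = k then axis j 1
    else (\<chi> i. (if i = j then 1 else if i = k then \<i> ^ n else 0) / sqrt 2))"

lemma norm_frame_vec: "norm (frame_vec p) = 1"
proof -
  obtain j k n where p: "p = (j, k, n)" by (cases p)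
  show ?thesis
  proof (cases "j = k")
    case True
    then show ?thesis by (simp add: p frame_vec_def)
  next
    case False
    have "(\<Sum>i\<in>UNIV. (norm (frame_vec p $ i))\<^sup>2)
        = (\<Sum>i\<in>UNIV. (if i = j then 1/2 else 0) + (if i = k then 1/2 else 0))"
      using False
      by (intro sum.cong) (auto simp: p frame_vec_def norm_divide norm_power power_divide)
    also have "\<dots> = 1" by (simp add: sum.distrib)
    finally show ?thesis by (simp add: norm_vec_def L2_set_def)
  qed
qed

lemma proj_frame_vec:
  "proj (frame_vec (j, k, n)) = (if j = k then matrix_unit j j
    else (1/2) *\<^sub>M (matrix_unit j j + matrix_unit k k
      + cnj (\<i> ^ n) *\<^sub>M matrix_unit j k + \<i> ^ n *\<^sub>M matrix_unit k j))"
proof -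
  have s: "complex_of_real (sqrt 2) * complex_of_real (sqrt 2) = 2"
    by (simp flip: of_real_mult)
  \<comment> \<open>The phase has modulus one, which fixes the diagonal entry at k; its conjugate
    appears as a power of -\<i>.\<close>
  have u: "\<i> ^ n * (- \<i>) ^ n = 1"
    by (simp flip: power_mult_distrib)
  show ?thesis
    using s u by (auto simp: vec_eq_iff frame_vec_def matrix_unit_def axis_def)
qed

text \<open>The four phases sum to zero, so the off-diagonal terms cancel; for j = k there are four
  equal copies.\<close>

lemma sum_phases_proj_frame_vec:
  "(\<Sum>n<4. proj (frame_vec (j, k, n))) = 2 *\<^sub>M (matrix_unit j j + matrix_unit k k)"
  by (auto simp: proj_frame_vec vec_eq_iff eval_nat_numeral field_simps)

text \<open>A discrete Fourier filter: the weight cancels the conjugate phase at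
  \<open>matrix_unit j k\<close>, while \<open>\<i> ^ n\<close> and \<open>\<i> ^ (2 * n)\<close>
  sum to zero over n < 4 and remove the other terms. For j = k the weight 1/4 averages equal
  copies.\<close>

lemma sum_phases_weighted_proj_frame_vec:
  "(\<Sum>n<4. (if j = k then 1/4 else \<i> ^ n / 2) *\<^sub>M proj (frame_vec (j, k, n))) = matrix_unit j k"
  by (auto simp: proj_frame_vec vec_eq_iff eval_nat_numeral algebra_simps)

text \<open>Each ordered pair (j, k) contributes twice the two diagonal units. With d =
  \<open>CARD('n)\<close>, every index occurs d times in either slot, hence 2 (d + d) = 4 d.\<close>

lemma sum_proj_frame_vec:
  "(\<Sum>p\<in>UNIV \<times> UNIV \<times> {..<4}. proj (frame_vec p :: complex ^ 'n))
    = (4 * real CARD('n)) *\<^sub>R mat 1"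
proof -
  have "(\<Sum>p\<in>UNIV \<times> UNIV \<times> {..<4}. proj (frame_vec p :: complex ^ 'n))
      = (\<Sum>j\<in>UNIV. \<Sum>k\<in>UNIV. \<Sum>n<4. proj (frame_vec (j, k, n) :: complex ^ 'n))"
    by (simp add: sum.cartesian_product split_def)
  also have "\<dots> = (\<Sum>j\<in>UNIV. \<Sum>k\<in>UNIV. 2 *\<^sub>M (matrix_unit j j + matrix_unit k k :: complex ^ 'n ^ 'n))"
    by (simp add: sum_phases_proj_frame_vec)
  also have "\<dots> = 2 *\<^sub>M ((\<Sum>j\<in>UNIV. \<Sum>k\<in>(UNIV :: 'n set). matrix_unit j j)
      + (\<Sum>j\<in>(UNIV :: 'n set). \<Sum>k\<in>UNIV. matrix_unit k k :: complex ^ 'n ^ 'n))"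
    by (simp add: sum.distrib flip: cmat.scale_sum_right)
  also have "(\<Sum>j\<in>UNIV. \<Sum>k\<in>(UNIV :: 'n set). matrix_unit j j :: complex ^ 'n ^ 'n)
      = (\<Sum>j\<in>(UNIV :: 'n set). \<Sum>k\<in>UNIV. matrix_unit k k)"
    by (rule sum.swap)
  also have "\<dots> = real CARD('n) *\<^sub>R mat 1"
    by (simp add: sum_matrix_unit_diag sum_constant_scaleR del: sum_constant)
  also have "2 *\<^sub>M (real CARD('n) *\<^sub>R mat 1 + real CARD('n) *\<^sub>R mat 1 :: complex ^ 'n ^ 'n)
      = (4 * real CARD('n)) *\<^sub>R mat 1"
    by (simp add: vec_eq_iff scaleR_conv_of_real[where 'a = complex])
  finally show ?thesis .
qed

lemma proj_frame_vec_expansion: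
  obtains \<gamma> where "A = (\<Sum>p\<in>UNIV \<times> UNIV \<times> {..<4}. \<gamma> p *\<^sub>M proj (frame_vec p))"
proof
  define \<gamma> where "\<gamma> = (\<lambda>(j, k, n). A $ j $ k * (if j = k then 1/4 else \<i> ^ n / 2))"
  have "A = (\<Sum>j\<in>UNIV. \<Sum>k\<in>UNIV. A $ j $ k *\<^sub>M
      (\<Sum>n<4. (if j = k then 1/4 else \<i> ^ n / 2) *\<^sub>M proj (frame_vec (j, k, n))))"
    unfolding sum_phases_weighted_proj_frame_vec by (rule matrix_unit_expansion)
  also have "\<dots> = (\<Sum>j\<in>UNIV. \<Sum>k\<in>UNIV. \<Sum>n<4. \<gamma> (j, k, n) *\<^sub>M proj (frame_vec (j, k, n)))"
    by (simp add: \<gamma>_def cmat.scale_sum_right)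
  also have "\<dots> = (\<Sum>p\<in>UNIV \<times> UNIV \<times> {..<4}. \<gamma> p *\<^sub>M proj (frame_vec p))"
    by (simp add: sum.cartesian_product split_def)
  finally show "A = \<dots>" .
qed

text \<open>Spanning is expressed by the existence of coefficients because these become the \<gamma>
  of the theorem.\<close>

lemma ic_tight_frame_exists:
  obtains M :: nat and \<phi> :: "nat \<Rightarrow> complex ^ 'n" and \<alpha> :: real
  where "\<And>m. m < M \<Longrightarrow> norm (\<phi> m) = 1" "\<alpha> > 0" "(\<Sum>m<M. proj (\<phi> m)) = \<alpha> *\<^sub>R mat 1"
    "\<And>A. \<exists>\<gamma>. A = (\<Sum>m<M. \<gamma> m *\<^sub>M proj (\<phi> m))"
proof -
  let ?I = "UNIV \<times> UNIV \<times> {..<4} :: ('n \<times> 'n \<times> nat) set"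
  obtain h where h: "bij_betw h {..<card ?I} ?I"
    using ex_bij_betw_nat_finite[of ?I] by (auto simp: atLeast0LessThan)
  show ?thesis
  proof
    show "norm (frame_vec (h m)) = 1" for m
      by (rule norm_frame_vec)
    show "4 * real CARD('n) > 0"
      by simp
    show "(\<Sum>m<card ?I. proj (frame_vec (h m))) = (4 * real CARD('n)) *\<^sub>R mat 1"
      using sum.reindex_bij_betw[OF h, of "\<lambda>p. proj (frame_vec p)"] by (simp add: sum_proj_frame_vec)
    show "\<exists>\<gamma>. A = (\<Sum>m<card ?I. \<gamma> m *\<^sub>M proj (frame_vec (h m)))" for A :: "complex ^ 'n ^ 'n"
    proof -
      obtain \<gamma> where "A = (\<Sum>p\<in>?I. \<gamma> p *\<^sub>M proj (frame_vec p))"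
        by (rule proj_frame_vec_expansion)
      then have "A = (\<Sum>m<card ?I. \<gamma> (h m) *\<^sub>M proj (frame_vec (h m)))"
        using sum.reindex_bij_betw[OF h, of "\<lambda>p. \<gamma> p *\<^sub>M proj (frame_vec p)"] by simp
      then show ?thesis by (rule exI[of _ "\<gamma> \<circ> h", simplified comp_def])
    qed
  qed
qed

lemma informationally_completeI:
  assumes "\<And>A. \<exists>\<gamma>. A = (\<Sum>m<M. \<gamma> m *\<^sub>M proj (\<phi> m))"
  shows "informationally_complete M \<phi>"
proof -
  have "A \<in> cmat.span ((\<lambda>m. proj (\<phi> m)) ` {..<M})" for A
  proof -
    obtain \<gamma> where "A = (\<Sum>m<M. \<gamma> m *\<^sub>M proj (\<phi> m))"
      using assms by blast
    then show ?thesis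
      by (simp only:) (intro cmat.span_sum cmat.span_scale cmat.span_base imageI)
  qed
  then show ?thesis by (auto simp: informationally_complete_def)
qed

subsection \<open>The controlled swap\<close>

text \<open>A sum of tensor products of \<open>P j\<close> with a permutation matrix;
  \<open>r\<close> is the initial index of the ancilla. The ancilla is permuted in its standard
  basis, whichever basis of the system the \<open>P j\<close> belong to.\<close>

definition controlled_swap :: "('n \<Rightarrow> complex ^ 'n ^ 'n) \<Rightarrow> 'n \<Rightarrow> complex ^ ('n \<times> 'n) ^ ('n \<times> 'n)"
  where "controlled_swap P r = (\<chi> p q. \<Sum>j\<in>UNIV. P j $ fst p $ fst q *
    (if snd p = Transposition.transpose r j (snd q) then 1 else 0))"

text \<open>Transpositions are involutions and the \<open>P j\<close> are orthogonal projectors, so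
  the matrix is self-adjoint and squares to the sum of the \<open>P j\<close> tensor the
  identity.\<close>

lemma unitary_controlled_swap:
  fixes P :: "'n \<Rightarrow> complex ^ 'n ^ 'n"
  assumes adj: "\<And>j. adj (P j) = P j"
    and orth: "\<And>j k. P j ** P k = (if j = k then P j else 0)"
    and one: "(\<Sum>j\<in>UNIV. P j) = mat 1"
  shows "unitary (controlled_swap P r)"
proof -
  let ?U = "controlled_swap P r" and ?\<tau> = "Transposition.transpose r"
  have "cnj (P j $ b $ a) = P j $ a $ b" for j a b
    using adj[of j] by (simp add: vec_eq_iff)
  moreover have "t = ?\<tau> j s \<longleftrightarrow> s = ?\<tau> j t" for j s t
    by (metis transpose_involutory)
  ultimately have self: "adj ?U = ?U"
    by (simp add: vec_eq_iff controlled_swap_def if_distrib cong: if_cong)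
  have "(?U ** ?U) $ (a, s) $ (b, t) = mat 1 $ (a, s) $ (b, t)" for a s b t
  proof -
    have "(?U ** ?U) $ (a, s) $ (b, t) = (\<Sum>c\<in>UNIV. \<Sum>u\<in>UNIV.
        (\<Sum>j\<in>UNIV. P j $ a $ c * (if s = ?\<tau> j u then 1 else 0))
        * (\<Sum>k\<in>UNIV. P k $ c $ b * (if u = ?\<tau> k t then 1 else 0)))"
      by (simp add: matrix_matrix_mult_def controlled_swap_def sum.cartesian_product split_def
          flip: UNIV_Times_UNIV)
    also have "\<dots> = (\<Sum>c\<in>UNIV. \<Sum>u\<in>UNIV. \<Sum>j\<in>UNIV. \<Sum>k\<in>UNIV.
        if u = ?\<tau> k t then P j $ a $ c * P k $ c $ b * (if s = ?\<tau> j u then 1 else 0) else 0)"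
      by (intro sum.cong refl) (auto simp: sum_product intro!: sum.cong)
    also have "\<dots> = (\<Sum>c\<in>UNIV. \<Sum>j\<in>UNIV. \<Sum>k\<in>UNIV. \<Sum>u\<in>UNIV.
        if u = ?\<tau> k t then P j $ a $ c * P k $ c $ b * (if s = ?\<tau> j u then 1 else 0) else 0)"
      by (intro sum.cong refl sum_rotate)
    also have "\<dots> = (\<Sum>c\<in>UNIV. \<Sum>j\<in>UNIV. \<Sum>k\<in>UNIV.
        P j $ a $ c * P k $ c $ b * (if s = ?\<tau> j (?\<tau> k t) then 1 else 0))"
      by simp
    also have "\<dots> = (\<Sum>j\<in>UNIV. \<Sum>k\<in>UNIV. \<Sum>c\<in>UNIV.
        P j $ a $ c * P k $ c $ b * (if s = ?\<tau> j (?\<tau> k t) then 1 else 0))"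
      by (rule sum_rotate)
    also have "\<dots> = (\<Sum>j\<in>UNIV. \<Sum>k\<in>UNIV. (P j ** P k) $ a $ b * (if s = ?\<tau> j (?\<tau> k t) then 1 else 0))"
      by (simp add: matrix_matrix_mult_def sum_distrib_right)
    \<comment> \<open>Orthogonality removes the terms with distinct j and k; in the remaining ones
      the same swap acts twice.\<close>
    also have "\<dots> = (\<Sum>j\<in>UNIV. \<Sum>k\<in>UNIV. if k = j then P j $ a $ b * (if s = t then 1 else 0) else 0)"
      by (intro sum.cong refl) (auto simp: orth)
    also have "\<dots> = (\<Sum>j\<in>UNIV. P j) $ a $ b * (if s = t then 1 else 0)"
      by (simp add: sum_distrib_right)
    finally show ?thesis
      by (simp add: one mat_def)
  qed
  then have "?U ** ?U = mat 1"
    by (simp add: vec_eq_iff)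
  then show ?thesis by (simp add: unitary_def self)
qed

text \<open>In the branch of \<open>P s\<close> the swap moves the ancilla from \<open>r\<close> to
  \<open>s\<close>, where the bra reads off the amplitude \<open>cnj (v $ s)\<close>.\<close>

lemma ancilla_slice_controlled_swap:
  "id_tensor_bra v ** controlled_swap P r ** id_tensor_ket (axis r 1) = (\<Sum>s\<in>UNIV. cnj (v $ s) *\<^sub>M P s)"
proof -
  have "(id_tensor_bra v ** controlled_swap P r ** id_tensor_ket (axis r 1)) $ a $ b
      = (\<Sum>s\<in>UNIV. cnj (v $ s) * P s $ a $ b)" for a b
  proof -
    let ?U = "controlled_swap P r"
    have bra: "(id_tensor_bra v ** ?U) $ a $ q = (\<Sum>s\<in>UNIV. cnj (v $ s) * ?U $ (a, s) $ q)" for q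
    proof -
      have "(id_tensor_bra v ** ?U) $ a $ q
          = (\<Sum>c\<in>UNIV. \<Sum>s\<in>UNIV. (if a = c then 1 else 0) * cnj (v $ s) * ?U $ (c, s) $ q)"
        by (simp add: matrix_matrix_mult_def id_tensor_bra_def mat_def sum.cartesian_product split_def
            flip: UNIV_Times_UNIV)
      also have "\<dots> = (\<Sum>c\<in>UNIV. if a = c then \<Sum>s\<in>UNIV. cnj (v $ s) * ?U $ (c, s) $ q else 0)"
        by (intro sum.cong refl) auto
      finally show ?thesis by simp
    qed
    have ket: "(X ** id_tensor_ket (axis r 1)) $ a $ b = X $ a $ (b, r)"
      for X :: "complex ^ ('a \<times> 'a) ^ 'a"
    proof -
      have "(X ** id_tensor_ket (axis r 1)) $ a $ b
          = (\<Sum>q\<in>UNIV. if q = (b, r) then X $ a $ q else 0)"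
        unfolding matrix_matrix_mult_def id_tensor_ket_def
        by (auto simp: mat_def axis_def prod_eq_iff intro!: sum.cong)
      then show ?thesis by simp
    qed
    show ?thesis
      unfolding ket bra by (simp add: controlled_swap_def if_distrib cong: if_cong)
  qed
  then show ?thesis by (simp add: vec_eq_iff)
qed

section \<open>Assembling the Kraus family and its coefficients\<close>

lemma sandwich_sum:
  fixes P :: "'i \<Rightarrow> complex ^ 'n ^ 'n"
  assumes "\<And>j. adj (P j) = P j"
  shows "(\<Sum>s\<in>I. c s *\<^sub>M P s) ** \<rho> ** adj (\<Sum>t\<in>I. c t *\<^sub>M P t)
    = (\<Sum>s\<in>I. \<Sum>t\<in>I. (c s * cnj (c t)) *\<^sub>M (P s ** \<rho> ** P t))"
  by (simp add: adj_sum adj_cscale assms sum_matrix_mult_left sum_matrix_mult_right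
      cscale_matrix_mult_left cscale_matrix_mult_right cmat.scale_sum_right mult_ac) (rule sum.swap)

theorem theorem1:
  fixes e :: "nat \<Rightarrow> complex ^ 'n"
  assumes "orthonormal_basis e"
  shows "\<exists>(M :: nat) (K :: nat \<Rightarrow> complex ^ 'n ^ 'n) (\<gamma> :: nat \<Rightarrow> nat \<Rightarrow> complex).
           kraus_family M K \<and> realized_by_ic_ancilla M K \<and>
           (\<forall>x<CARD('n). \<forall>\<rho>. density_matrix \<rho> \<longrightarrow>
              \<rho> ** proj (e x) = (\<Sum>m<M. \<gamma> x m *\<^sub>M (K m ** \<rho> ** adj (K m))))"
proof -
  \<comment> \<open>The basis is numbered by \<open>nat\<close>, but the swap needs projectors
    labelled by the ancilla index type; \<open>b\<close> translates.\<close>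
  obtain b :: "'n \<Rightarrow> nat" where b: "bij_betw b UNIV {..<CARD('n)}"
    using ex_bij_betw_finite_nat[of "UNIV :: 'n set"] by (auto simp: atLeast0LessThan)
  define P where "P j = proj (e (b j))" for j
  have ortho: "cinner (e (b j)) (e (b k)) = (if j = k then 1 else 0)" for j k
  proof -
    have "b j < CARD('n)" "b k < CARD('n)" "b j = b k \<longleftrightarrow> j = k"
      using b by (auto simp: bij_betw_def inj_on_def)
    with assms show ?thesis by (simp add: orthonormal_basis_def)
  qed
  have P_adj: "adj (P j) = P j" for j
    by (simp add: P_def)
  have P_orth: "P j ** P k = (if j = k then P j else 0)" for j k
    unfolding P_def proj_mult_proj ortho by (simp add: proj_def)
  have P_one: "(\<Sum>j\<in>UNIV. P j) = mat 1"
    unfolding P_def using ortho by (rule sum_proj_orthonormal)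
  obtain M :: nat and \<phi> :: "nat \<Rightarrow> complex ^ 'n" and \<alpha> :: real
    where norm: "\<And>m. m < M \<Longrightarrow> norm (\<phi> m) = 1" and pos: "\<alpha> > 0"
      and tight: "(\<Sum>m<M. proj (\<phi> m)) = \<alpha> *\<^sub>R mat 1"
      and ic: "\<And>A. \<exists>\<gamma>. A = (\<Sum>m<M. \<gamma> m *\<^sub>M proj (\<phi> m))"
    using ic_tight_frame_exists by blast
  define c where "c m s = cnj (\<phi> m $ s) / sqrt \<alpha>" for m s
  define K where "K m = (\<Sum>s\<in>UNIV. c m s *\<^sub>M P s)" for m
  \<comment> \<open>The indices come out transposed because the amplitudes of \<open>K m\<close> are
    conjugated entries of \<open>\<phi> m\<close>.\<close>
  have cc: "c m s * cnj (c m t) = proj (\<phi> m) $ t $ s / \<alpha>" for m s t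
  proof -
    have "complex_of_real (sqrt \<alpha>) * complex_of_real (sqrt \<alpha>) = \<alpha>"
      using pos by (simp flip: of_real_mult)
    then show ?thesis by (simp add: c_def mult_ac)
  qed
  have adjK: "adj (K m) = (\<Sum>s\<in>UNIV. cnj (c m s) *\<^sub>M P s)" for m
    by (simp add: K_def adj_sum adj_cscale P_adj)
  have sandwich: "(\<Sum>m<M. g m *\<^sub>M (K m ** \<rho> ** adj (K m)))
      = (\<Sum>s\<in>UNIV. \<Sum>t\<in>UNIV. ((\<Sum>m<M. g m *\<^sub>M proj (\<phi> m)) $ t $ s / \<alpha>) *\<^sub>M (P s ** \<rho> ** P t))"
    for g \<rho>
  proof -
    have "(\<Sum>m<M. g m *\<^sub>M (K m ** \<rho> ** adj (K m)))
        = (\<Sum>m<M. \<Sum>s\<in>UNIV. \<Sum>t\<in>UNIV. (g m * (proj (\<phi> m) $ t $ s / \<alpha>)) *\<^sub>M (P s ** \<rho> ** P t))"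
      unfolding K_def sandwich_sum[of P, OF P_adj] cc by (simp add: cmat.scale_sum_right)
    also have "\<dots> = (\<Sum>s\<in>UNIV. \<Sum>t\<in>UNIV. \<Sum>m<M. (g m * (proj (\<phi> m) $ t $ s / \<alpha>)) *\<^sub>M (P s ** \<rho> ** P t))"
      by (rule sum_rotate)
    finally show ?thesis
      by (simp add: sum_divide_distrib cmat.scale_sum_left)
  qed
  have kraus: "kraus_family M K"
  proof -
    have "(\<Sum>m<M. adj (K m) ** K m)
        = (\<Sum>m<M. \<Sum>s\<in>UNIV. \<Sum>t\<in>UNIV. (proj (\<phi> m) $ s $ t / \<alpha>) *\<^sub>M (P s ** P t))"
    proof (rule sum.cong[OF refl])
      fix m
      \<comment> \<open>The identity and the double adjoint bring the product into the form of
        \<open>sandwich_sum\<close>, applied to \<open>adj (K m)\<close>.\<close>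
      have "adj (K m) ** K m = adj (K m) ** mat 1 ** adj (adj (K m))"
        by simp
      also have "\<dots> = (\<Sum>s\<in>UNIV. \<Sum>t\<in>UNIV. (c m t * cnj (c m s)) *\<^sub>M (P s ** P t))"
        unfolding adjK sandwich_sum[of P, OF P_adj] by (simp add: mult.commute)
      finally show "adj (K m) ** K m
          = (\<Sum>s\<in>UNIV. \<Sum>t\<in>UNIV. (proj (\<phi> m) $ s $ t / \<alpha>) *\<^sub>M (P s ** P t))"
        unfolding cc .
    qed
    also have "\<dots> = (\<Sum>s\<in>UNIV. \<Sum>t\<in>UNIV. \<Sum>m<M. (proj (\<phi> m) $ s $ t / \<alpha>) *\<^sub>M (P s ** P t))"
      by (rule sum_rotate)
    also have "\<dots> = (\<Sum>s\<in>UNIV. \<Sum>t\<in>UNIV. ((\<Sum>m<M. proj (\<phi> m)) $ s $ t / \<alpha>) *\<^sub>M (P s ** P t))"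
      by (simp add: sum_divide_distrib cmat.scale_sum_left)
    also have "\<dots> = (\<Sum>s\<in>UNIV. \<Sum>t\<in>UNIV. if s = t then P s else 0)"
      unfolding tight using pos
      by (intro sum.cong refl) (auto simp: P_orth mat_def scaleR_conv_of_real[where 'a = complex])
    finally show ?thesis by (simp add: kraus_family_def P_one)
  qed
  have realized: "realized_by_ic_ancilla M K"
    unfolding realized_by_ic_ancilla_def
  proof (intro exI conjI allI impI)
    \<comment> \<open>\<open>undefined\<close> serves as an arbitrary ancilla index: any basis
      vector can be the initial state.\<close>
    show "unitary (controlled_swap P undefined)"
      by (rule unitary_controlled_swap[OF P_adj P_orth P_one])
    show "norm (axis undefined 1 :: complex ^ 'n) = 1"
      by simp
    show "informationally_complete M \<phi>"
      using ic by (rule informationally_completeI)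
    show "K m = (1 / sqrt \<alpha>) *\<^sub>R
        (id_tensor_bra (\<phi> m) ** controlled_swap P undefined ** id_tensor_ket (axis undefined 1))" for m
      unfolding ancilla_slice_controlled_swap K_def c_def
      by (simp add: vec_eq_iff sum_divide_distrib scaleR_conv_of_real[where 'a = complex])
  qed (use norm pos tight in auto)
  \<comment> \<open>Choosing \<open>g\<close> before \<rho> makes the coefficients independent of
    the state.\<close>
  have "\<forall>x\<in>{..<CARD('n)}. \<exists>g. \<forall>\<rho>. \<rho> ** proj (e x) = (\<Sum>m<M. g m *\<^sub>M (K m ** \<rho> ** adj (K m)))"
  proof
    fix x assume x: "x \<in> {..<CARD('n)}"
    have "x \<in> range b"
      using b x by (simp add: bij_betw_def)
    then obtain y where y: "b y = x" by auto
    \<comment> \<open>Row \<open>y\<close> of this matrix is constant: it pins the right projector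
      to \<open>P y\<close> and leaves the left index free, so the left projectors sum to the
      identity. The entry \<alpha> cancels the normalization in \<open>cc\<close>.\<close>
    obtain g where g: "(\<chi> t s. if t = y then \<alpha> else 0) = (\<Sum>m<M. g m *\<^sub>M proj (\<phi> m))"
      using ic[of "\<chi> t s. if t = y then \<alpha> else 0"] by blast
    have "(\<Sum>m<M. g m *\<^sub>M (K m ** \<rho> ** adj (K m))) = \<rho> ** proj (e x)" for \<rho>
    proof -
      have "(\<Sum>m<M. g m *\<^sub>M (K m ** \<rho> ** adj (K m)))
          = (\<Sum>s\<in>UNIV. \<Sum>t\<in>UNIV. if t = y then P s ** \<rho> ** P t else 0)"
        unfolding sandwich g[symmetric] using pos by (intro sum.cong refl) auto
      also have "\<dots> = (\<Sum>s\<in>UNIV. P s) ** \<rho> ** P y"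
        by (simp add: sum_matrix_mult_left)
      finally show ?thesis unfolding P_one by (simp add: P_def y)
    qed
    then show "\<exists>g. \<forall>\<rho>. \<rho> ** proj (e x) = (\<Sum>m<M. g m *\<^sub>M (K m ** \<rho> ** adj (K m)))"
      by (intro exI[of _ g] allI) simp
  qed
  from bchoice[OF this] obtain \<gamma> where "\<forall>x<CARD('n). \<forall>\<rho>.
      \<rho> ** proj (e x) = (\<Sum>m<M. \<gamma> x m *\<^sub>M (K m ** \<rho> ** adj (K m)))"
    by auto
  with kraus realized show ?thesis
    by (intro exI[of _ M] exI[of _ K] exI[of _ \<gamma>] conjI) auto
qed

end
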